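(* Let $\mu$ and $\nu$ be centered log-concave probability measures on $\mathbb{Z}$, and let $X$ (resp. $Y$) denote a random variable with distribution $\mu$ (resp. $\nu$). Then $$ W_1(\mu, \nu) \leq 4\, d_{LP}(\mu, \nu)\, \bigl(2\max\{\mathbb{E}[|X|],\mathbb{E}[|Y|]\} + 1\bigr) \log \left(\frac{4e\,(\mathbb{E}[|X|]+\mathbb{E}[|Y|]+1)}{(2\max\{\mathbb{E}[|X|],\mathbb{E}[|Y|]\} + 1)\, d_{LP}(\mu, \nu)} \right), $$ where the right-hand side is interpreted as $0$ when $d_{LP}(\mu,\nu)=0$.
   Context: A probability measure on $\mathbb{Z}$ with probability mass function $p$ (equivalently, an integer-valued random variable with that distribution) is log-concave if $p(k)^2 \geq p(k-1)p(k+1)$ for all $k \in \mathbb{Z}$ and its support $\{k\in\mathbb{Z} : p(k)>0\}$ is an integer interval (a set of consecutive integers, possibly infinite). It is centered if its mean is $0$. (Log-concave distributions on $\mathbb{Z}$ have finite moments of all orders.) Measures on $\mathbb{Z}$ are viewed as measures on $\mathbb{R}$. The Lévy-Prokhorov distance is $d_{LP}(\mu,\nu) = \inf\{\varepsilon>0 : \mu(A) \leq \nu(A^{\varepsilon}) + \varepsilon \text{ for all Borel sets } A \subset \mathbb{R}\}$, where $A^{\varepsilon} = \{x\in\mathbb{R} : d(x,A)<\varepsilon\}$ and $d(x,A)=\inf_{y\in A}|x-y|$ (so $\emptyset^{\varepsilon}=\emptyset$). The $1$-Wasserstein distance is $W_1(\mu,\nu) = \inf \mathbb{E}[|X-Y|]$,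 where the infimum runs over all couplings $(X,Y)$ with $X$ of distribution $\mu$ and $Y$ of distribution $\nu$. $\log$ is the natural logarithm. *)

theory Defs
  imports "HOL-Probability.Probability"
begin

definition log_concave_pmf :: "int pmf \<Rightarrow> bool" where
  "log_concave_pmf p \<longleftrightarrow>
     (\<forall>k. pmf p (k - 1) * pmf p (k + 1) \<le> (pmf p k)\<^sup>2) \<and>
     (\<forall>i j k. i \<in> set_pmf p \<and> k \<in> set_pmf p \<and> i \<le> j \<and> j \<le> k \<longrightarrow> j \<in> set_pmf p)"

(* Integrability is explicit because the Bochner integral of a non-integrable function is 0 by
   convention. *)
definition centered_pmf :: "int pmf \<Rightarrow> bool" where
  "centered_pmf p \<longleftrightarrow>
     integrable (measure_pmf p) real_of_int \<and> measure_pmf.expectation p real_of_int = 0"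

definition real_law :: "int pmf \<Rightarrow> real measure" where
  "real_law p = distr (measure_pmf p) borel real_of_int"

(* The empty set is treated separately because infdist x {} = 0. *)
definition thickening :: "real \<Rightarrow> real set \<Rightarrow> real set" where
  "thickening \<epsilon> A = (if A = {} then {} else {x. infdist x A < \<epsilon>})"

definition levy_prokhorov :: "real measure \<Rightarrow> real measure \<Rightarrow> real" where
  "levy_prokhorov M N =
     Inf {\<epsilon>. \<epsilon> > 0 \<and> (\<forall>A \<in> sets borel. measure M A \<le> measure N (thickening \<epsilon> A) + \<epsilon>)}"

(* A coupling is given by the joint law of (X, Y). *)
definition couplings :: "real measure \<Rightarrow> real measure \<Rightarrow> (real \<times> real) measure set" where
  "couplings M N =
     {P. prob_space P \<and> sets P = sets (borel \<Otimes>\<^sub>M borel) \<and>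
         distr P borel fst = M \<and> distr P borel snd = N}"

definition wasserstein1 :: "real measure \<Rightarrow> real measure \<Rightarrow> ennreal" where
  "wasserstein1 M N = (INF P \<in> couplings M N. \<integral>\<^sup>+ z. ennreal \<bar>fst z - snd z\<bar> \<partial>P)"

end

theory Submission
  imports Defs
begin

text \<open>
  Write \<open>d\<close> for the Levy-Prokhorov distance, \<open>a\<close> and \<open>b\<close> for the absolute first moments, and
  \<open>K = 2 * max a b + 1\<close>.  Two integers at distance less than 1 are equal, so \<open>d\<close> dominates the total
  variation distance (\<open>measure_diff_le_levy_prokhorov\<close>).  The maximal coupling leaves the common mass
  in place, and paying \<open>\<bar>x\<bar> + \<bar>y\<bar>\<close> for moving \<open>x\<close> to \<open>y\<close> bounds the Wasserstein distance by the sum of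
  \<open>\<bar>k\<bar> * \<bar>\<mu> k - \<nu> k\<bar>\<close> (\<open>wasserstein1_le_weighted_variation\<close>).  Summed in layers, this is the sum
  over \<open>n \<ge> 1\<close> of the mass of \<open>\<bar>\<mu> - \<nu>\<bar>\<close> outside \<open>{-n<..<n}\<close>.

  That mass is at most \<open>2 * d\<close>, and also at most the sum of the tails of \<open>\<mu>\<close> and \<open>\<nu>\<close>.  A centered
  log-concave law has tail at most \<open>2 * exp (- n / (4 * a + 2))\<close> (\<open>log_concave_abs_tail\<close>):
  Markov's inequality shows that a block of length about \<open>4 * a\<close> around the origin reduces the upper
  tail by a factor 3, log-concavity makes this factor persist for all later blocks, and \<open>3 > e\<close> leaves
  room for rounding.  Hence the terms are at most the minimum of \<open>2 * d\<close> and
  \<open>4 * exp (- n / (2 * K))\<close>, and their sum is at most \<open>4 * d * K * (1 + ln (2 / d))\<close>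
  (\<open>suminf_min_exp_le\<close>).  This is the claimed bound because \<open>K \<le> 2 * (a + b + 1)\<close>.
\<close>

section \<open>Tails of log-concave distributions\<close>

text \<open>The ratio of neighbouring weights is nonincreasing, written without division.  Contiguity of the
  support enters exactly where an intermediate weight vanishes and cannot be cancelled.\<close>

lemma log_concave_pmf_shift_one:
  assumes "log_concave_pmf p" and "l \<le> k"
  shows "pmf p (k + 1) * pmf p l \<le> pmf p k * pmf p (l + 1)"
  using assms(2)
proof (induction k rule: int_ge_induct)
  case base
  show ?case by (simp add: mult.commute)
next
  case (step k)
  have lc: "pmf p k * pmf p (k + 2) \<le> (pmf p (k + 1))\<^sup>2"
    using assms(1) unfolding log_concave_pmf_def
    by (metis add_diff_cancel_right' add.assoc one_add_one)
  show ?case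
  proof (cases "pmf p k = 0")
    case True
    then have "pmf p (k + 2) = 0 \<or> pmf p l = 0"
      using assms(1) step.hyps unfolding log_concave_pmf_def set_pmf_iff
      by (smt (verit))
    then show ?thesis by (auto simp: add.assoc)
  next
    case False
    then have pos: "pmf p k > 0" by (simp add: pmf_pos)
    have "pmf p k * (pmf p (k + 2) * pmf p l) \<le> pmf p (k + 1) * (pmf p (k + 1) * pmf p l)"
      using mult_right_mono[OF lc pmf_nonneg[of p l]] by (simp add: power2_eq_square mult.assoc)
    also have "\<dots> \<le> pmf p (k + 1) * (pmf p k * pmf p (l + 1))"
      by (intro mult_left_mono step.IH) simp
    finally have "pmf p k * (pmf p (k + 2) * pmf p l) \<le> pmf p k * (pmf p (k + 1) * pmf p (l + 1))"
      by (simp add: mult_ac)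
    then show ?thesis using pos by (simp add: add.assoc)
  qed
qed

lemma log_concave_pmf_shift:
  assumes "log_concave_pmf p" and "l \<le> k"
  shows "pmf p (k + int i) * pmf p l \<le> pmf p k * pmf p (l + int i)"
proof (induction i)
  case 0
  show ?case by simp
next
  case (Suc i)
  let ?a = "pmf p (k + int i)" and ?b = "pmf p (l + int i)"
  have shift: "pmf p (k + int (Suc i)) * ?b \<le> ?a * pmf p (l + int (Suc i))"
    using log_concave_pmf_shift_one[OF assms(1), of "l + int i" "k + int i"] assms(2)
    by (simp add: add_ac)
  show ?case
  proof (cases "?a = 0 \<or> ?b = 0")
    case True
    then have "pmf p (k + int (Suc i)) = 0 \<or> pmf p l = 0"
      using assms unfolding log_concave_pmf_def set_pmf_iff
      by (smt (verit) of_nat_Suc of_nat_0_le_iff)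
    then show ?thesis by auto
  next
    case False
    then have pos: "?a * ?b > 0" by (simp add: pmf_pos)
    have "(?a * ?b) * (pmf p (k + int (Suc i)) * pmf p l)
        = (pmf p (k + int (Suc i)) * ?b) * (?a * pmf p l)" by (simp add: mult_ac)
    also have "\<dots> \<le> (?a * pmf p (l + int (Suc i))) * (pmf p k * ?b)"
      by (intro mult_mono shift Suc.IH) auto
    finally have "(?a * ?b) * (pmf p (k + int (Suc i)) * pmf p l)
        \<le> (?a * ?b) * (pmf p k * pmf p (l + int (Suc i)))" by (simp add: mult_ac)
    then show ?thesis using pos mult_le_cancel_left_pos by blast
  qed
qed

lemma measure_pmf_upset_split:
  fixes p :: "int pmf"
  shows "measure p {l..} = measure p {l + int i..} + (\<Sum>j<i. pmf p (l + int j))"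
proof (induction i)
  case 0
  show ?case by simp
next
  case (Suc i)
  have *: "{l + int i..} = {l + int i} \<union> {l + int (Suc i)..}" by auto
  have "measure p {l + int i..} = pmf p (l + int i) + measure p {l + int (Suc i)..}"
    unfolding * by (subst measure_pmf.finite_measure_Union) (auto simp: measure_pmf_single)
  then show ?case using Suc.IH by simp
qed

text \<open>Upper tails of a log-concave law are again log-concave.  Both upper sets lose a block of the same
  length \<open>i\<close> when they are shifted, so the claim reduces to comparing each single weight of the one
  block, times one tail, with the corresponding weight of the other block, times the other tail;
  this holds term by term by the shift inequality for weights.\<close>

lemma log_concave_tail_shift:
  assumes "log_concave_pmf p" and "l \<le> k"
  shows "measure p {k + int i..} * measure p {l..} \<le> measure p {k..} * measure p {l + int i..}"
proof -
  have point: "measure p {k + int i..} * pmf p (l + int j) \<le> pmf p (k + int j) * measure p {l + int i..}"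
    if "j < i" for j
  proof -
    have bij: "bij_betw (\<lambda>x. x + (k - l)) {l + int i..} {k + int i..}"
      by (rule bij_betwI[where g = "\<lambda>x. x - (k - l)"]) auto
    have summ: "Infinite_Set_Sum.abs_summable_on (\<lambda>x. pmf p (x + (k - l))) {l + int i..}"
      using abs_summable_on_reindex_bij_betw[OF bij, of "pmf p"] by auto
    have "measure p {k + int i..} * pmf p (l + int j)
        = infsetsum (\<lambda>x. pmf p (x + (k - l)) * pmf p (l + int j)) {l + int i..}"
      by (simp add: measure_pmf_conv_infsetsum infsetsum_cmult_left[OF summ]
            infsetsum_reindex_bij_betw[OF bij, of "pmf p"])
    also have "\<dots> \<le> infsetsum (\<lambda>x. pmf p (k + int j) * pmf p x) {l + int i..}"
    proof (rule infsetsum_mono)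
      fix x assume x: "x \<in> {l + int i..}"
      define r where "r = nat (x - (l + int j))"
      have r: "x = l + int j + int r" using x that by (simp add: r_def)
      show "pmf p (x + (k - l)) * pmf p (l + int j) \<le> pmf p (k + int j) * pmf p x"
        using log_concave_pmf_shift[OF assms(1), of "l + int j" "k + int j" r] assms(2)
        by (simp add: r algebra_simps)
    qed (auto intro!: abs_summable_on_cmult_left abs_summable_on_cmult_right summ)
    also have "\<dots> = pmf p (k + int j) * measure p {l + int i..}"
      by (simp add: measure_pmf_conv_infsetsum infsetsum_cmult_right pmf_abs_summable)
    finally show ?thesis .
  qed
  have "(\<Sum>j<i. measure p {k + int i..} * pmf p (l + int j))
      \<le> (\<Sum>j<i. pmf p (k + int j) * measure p {l + int i..})"
    by (intro sum_mono point) auto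
  then show ?thesis
    unfolding measure_pmf_upset_split[of p l i] measure_pmf_upset_split[of p k i]
    by (simp add: algebra_simps sum_distrib_left)
qed

lemma expectation_Markov:
  fixes p :: "'a pmf" and f :: "'a \<Rightarrow> real"
  assumes "integrable p f" and "\<And>x. 0 \<le> f x" and "\<And>x. x \<in> A \<Longrightarrow> c \<le> f x"
  shows "c * measure p A \<le> measure_pmf.expectation p f"
proof -
  have "c * measure p A = measure_pmf.expectation p (\<lambda>x. c * indicator A x)"
    by simp
  also have "\<dots> \<le> measure_pmf.expectation p f"
  proof (rule integral_mono)
    show "integrable p (\<lambda>x. c * indicator A x)"
      by (intro integrable_mult_right measure_pmf.integrable_const_bound[where B = 1]) auto
  qed (use assms in \<open>auto simp: indicator_def\<close>)
  finally show ?thesis .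
qed

abbreviation mean_abs :: "int pmf \<Rightarrow> real" where
  "mean_abs p \<equiv> measure_pmf.expectation p (\<lambda>k. \<bar>real_of_int k\<bar>)"

text \<open>Centering gives the factor 2 over Markov's inequality for \<open>\<bar>k\<bar>\<close>: the positive part
  \<open>(\<bar>k\<bar> + k) / 2\<close> carries exactly half of the absolute first moment.\<close>

lemma centered_pmf_tail_le:
  assumes "centered_pmf p" and "m > 0"
  shows "measure p {m..} \<le> mean_abs p / (2 * real_of_int m)"
proof -
  have int: "integrable p real_of_int" and mean: "measure_pmf.expectation p real_of_int = 0"
    using assms(1) by (auto simp: centered_pmf_def)
  have "real_of_int m * measure p {m..}
      \<le> measure_pmf.expectation p (\<lambda>k. (\<bar>real_of_int k\<bar> + real_of_int k) / 2)"
    using int by (intro expectation_Markov) (auto intro: integrable_abs)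
  also have "\<dots> = mean_abs p / 2"
    using int mean by (simp add: integrable_abs)
  finally show ?thesis using assms(2) by (simp add: field_simps)
qed

text \<open>
  Reflection transfers statements about upper tails to lower tails.
\<close>

definition reflect_pmf :: "int pmf \<Rightarrow> int pmf" where
  "reflect_pmf p = map_pmf uminus p"

lemma pmf_reflect: "pmf (reflect_pmf p) k = pmf p (- k)"
proof -
  have "pmf (map_pmf uminus p) (- (- k)) = pmf p (- k)"
    by (rule pmf_map_inj') (simp add: inj_def)
  then show ?thesis by (simp add: reflect_pmf_def)
qed

lemma log_concave_reflect:
  assumes "log_concave_pmf p"
  shows "log_concave_pmf (reflect_pmf p)"
  unfolding log_concave_pmf_def
proof (intro conjI allI impI)
  fix k
  have "pmf p (- k - 1) * pmf p (- k + 1) \<le> (pmf p (- k))\<^sup>2"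
    using assms unfolding log_concave_pmf_def by blast
  then show "pmf (reflect_pmf p) (k - 1) * pmf (reflect_pmf p) (k + 1) \<le> (pmf (reflect_pmf p) k)\<^sup>2"
    by (simp add: pmf_reflect mult.commute)
next
  fix i j k
  assume *: "i \<in> set_pmf (reflect_pmf p) \<and> k \<in> set_pmf (reflect_pmf p) \<and> i \<le> j \<and> j \<le> k"
  then have "- j \<in> set_pmf p"
    using assms unfolding log_concave_pmf_def set_pmf_iff pmf_reflect by (meson neg_le_iff_le)
  then show "j \<in> set_pmf (reflect_pmf p)"
    by (simp add: set_pmf_iff pmf_reflect)
qed

lemma centered_reflect: "centered_pmf p \<Longrightarrow> centered_pmf (reflect_pmf p)"
  by (simp add: centered_pmf_def reflect_pmf_def)

lemma mean_abs_reflect: "mean_abs (reflect_pmf p) = mean_abs p"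
  by (simp add: reflect_pmf_def)

lemma measure_reflect: "measure (reflect_pmf p) {m..} = measure p {..- m}"
  by (auto simp: reflect_pmf_def intro!: arg_cong[where f = "measure p"])

text \<open>With \<open>m\<close> at least twice the absolute mean, Markov's inequality on both sides leaves at most 1/4 of
  the mass above \<open>m\<close> and at least 3/4 of it above \<open>1 - m\<close>.  So one block of length \<open>2 * m - 1\<close>
  divides the tail by at least 3, and by log-concavity every later block does so as well.\<close>

lemma log_concave_tail_blocks:
  fixes p :: "int pmf"
  assumes lc: "log_concave_pmf p" and c: "centered_pmf p"
    and m: "m > 0" "2 * mean_abs p \<le> real_of_int m"
  shows "measure p {m + int j * (2 * m - 1)..} \<le> (1 / 4) * (1 / 3) ^ j"
proof -
  have quarter: "measure q {m..} \<le> 1 / 4"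
    if "centered_pmf q" "mean_abs q = mean_abs p" for q
  proof -
    have "measure q {m..} \<le> mean_abs p / (2 * real_of_int m)"
      using centered_pmf_tail_le[OF that(1) m(1)] that(2) by simp
    also have "\<dots> \<le> 1 / 4" using m by (simp add: field_simps)
    finally show ?thesis .
  qed
  define i where "i = nat (2 * m - 1)"
  have i: "int i = 2 * m - 1" using m by (simp add: i_def)
  have compl: "{1 - m..} = - {..- m}" by auto
  \<comment> \<open>The lower tail is the upper tail of the reflected law.\<close>
  have low: "measure p {1 - m..} \<ge> 3 / 4"
    using quarter[OF centered_reflect[OF c] mean_abs_reflect] measure_pmf.prob_compl[of "{..- m}" p]
    unfolding compl Compl_eq_Diff_UNIV measure_reflect by simp
  show ?thesis
  proof (induction j)
    case 0
    show ?case using quarter[OF c refl] by simp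
  next
    case (Suc j)
    let ?k = "m + int j * (2 * m - 1)"
    have "1 - m \<le> ?k" using m by (smt (verit) mult_nonneg_nonneg of_nat_0_le_iff)
    from log_concave_tail_shift[OF lc this, of i]
    have "measure p {?k + int i..} * measure p {1 - m..} \<le> measure p {?k..} * measure p {m..}"
      by (simp add: i)
    also have "\<dots> \<le> ((1 / 4) * (1 / 3) ^ j) * (1 / 4)"
      by (intro mult_mono Suc.IH quarter c refl) auto
    finally have "measure p {?k + int i..} * measure p {1 - m..} \<le> ((1 / 4) * (1 / 3) ^ j) * (1 / 4)" .
    moreover have "measure p {?k + int i..} * (3 / 4) \<le> measure p {?k + int i..} * measure p {1 - m..}"
      by (intro mult_left_mono low) simp
    ultimately have "measure p {?k + int i..} \<le> (1 / 4) * (1 / 3) ^ Suc j" by simp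
    then show ?case by (simp add: i algebra_simps)
  qed
qed

text \<open>Converts the ratio 1/3 per block to the rate \<open>exp (- 1)\<close>: since 3 exceeds \<open>e\<close>, two blocks
  together with the initial factor 1/4 already make up for the offset 3/2 that comes from the start
  of the first block and from rounding.\<close>

lemma third_power_le_exp:
  assumes "2 \<le> j"
  shows "(1 / 4) * (1 / 3) ^ j \<le> exp (- (real j + 3 / 2))"
  using assms
proof (induction j rule: dec_induct)
  case base
  have "exp (7 / 2 :: real) ^ 2 = exp 1 ^ 7"
    by (simp flip: exp_of_nat_mult)
  also have "\<dots> \<le> (272 / 100) ^ 7"
    using e_less_272 by (intro power_mono) auto
  also have "\<dots> \<le> 36\<^sup>2" by (simp add: power_divide)
  finally have "exp (7 / 2 :: real) \<le> 36" by (rule power2_le_imp_le) simp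
  then have "exp (- (7 / 2 :: real)) \<ge> 1 / 36"
    by (simp add: exp_minus field_simps)
  then show ?case by (simp add: power2_eq_square)
next
  case (step j)
  have "exp (-1 :: real) \<ge> 1 / 3"
    using e_less_272 by (simp add: exp_minus field_simps)
  then have "(1 / 4) * (1 / 3) ^ j * (1 / 3) \<le> exp (- (real j + 3 / 2)) * exp (-1)"
    by (intro mult_mono step.IH) auto
  also have "\<dots> = exp (- (real (Suc j) + 3 / 2))"
    by (simp flip: exp_add)
  finally show ?case by simp
qed

text \<open>This makes Markov's bound \<open>1 / (4 * u)\<close> at most \<open>2 * exp (- u)\<close> in the intermediate regime.\<close>

lemma exp_le_linear:
  assumes "1 / 2 \<le> u" "u \<le> (3 :: real)"
  shows "exp u \<le> 8 * u"
proof (cases "u \<le> 1")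
  case True
  then have "exp u \<le> exp 1" by simp
  then show ?thesis using e_less_272 assms by linarith
next
  case False
  \<comment> \<open>Dividing \<open>exp 3\<close> by a linear lower bound of \<open>exp (3 - u)\<close> reduces the claim to a quadratic in \<open>u\<close>.\<close>
  have "(1 + (3 - u)) * exp u \<le> exp (3 - u) * exp u"
    by (intro mult_right_mono exp_ge_add_one_self) simp
  also have "\<dots> = exp 1 ^ 3" by (simp flip: exp_add exp_of_nat_mult)
  also have "\<dots> \<le> (272 / 100) ^ 3"
    using e_less_272 by (intro power_mono) auto
  also have "\<dots> \<le> 24" by (simp add: power_divide)
  also have "\<dots> \<le> (4 - u) * (8 * u)"
    using mult_nonneg_nonneg[of "u - 1" "3 - u"] False assms by (simp add: algebra_simps)
  finally show ?thesis using assms by simp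
qed

text \<open>Beyond three units of the scale \<open>4 * mean_abs p + 2\<close> the loss from counting whole blocks is paid
  for by the gap between the rates \<open>ln 3\<close> and 1.\<close>

lemma log_concave_far_tail:
  fixes p :: "int pmf"
  assumes lc: "log_concave_pmf p" and c: "centered_pmf p"
    and n: "3 * (4 * mean_abs p + 2) \<le> real_of_int n"
  shows "measure p {n..} \<le> exp (- real_of_int n / (4 * mean_abs p + 2))"
proof -
  define a where "a = mean_abs p"
  have a: "a \<ge> 0" by (simp add: a_def)
  \<comment> \<open>The least integer above \<open>2 * a\<close>; unlike the ceiling it is positive also when \<open>a = 0\<close>.\<close>
  define m where "m = \<lfloor>2 * a\<rfloor> + 1"
  have m: "m > 0" "2 * a \<le> real_of_int m" "real_of_int m \<le> 2 * a + 1"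
    using a unfolding m_def by linarith+
  define j where "j = nat ((n - m) div (2 * m - 1))"
  have "real_of_int m \<le> real_of_int n" using n m(3) a by (simp flip: a_def)
  then have nm: "m \<le> n" by simp
  have j: "int j = (n - m) div (2 * m - 1)"
    using nm m by (simp add: j_def pos_imp_zdiv_nonneg_iff)
  define e where "e = (n - m) mod (2 * m - 1)"
  have split: "n - m = int j * (2 * m - 1) + e"
    unfolding j e_def by (rule div_mult_mod_eq[symmetric])
  have e: "0 \<le> e" "e < 2 * m - 1"
    unfolding e_def using m(1) by (simp_all add: pos_mod_sign pos_mod_bound del: minus_mod_int_eq)
  have lower: "m + int j * (2 * m - 1) \<le> n" using split e(1) by linarith
  have "n < m + (int j + 1) * (2 * m - 1)"
    using split e(2) by (simp add: distrib_right)
  then have "real_of_int n \<le> real_of_int (m + (int j + 1) * (2 * m - 1))"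
    by linarith
  also have "\<dots> = real_of_int m + (real j + 1) * (2 * real_of_int m - 1)" by simp
  also have "\<dots> \<le> (2 * a + 1) + (real j + 1) * (4 * a + 2)"
    using m by (intro add_mono mult_left_mono) auto
  also have "\<dots> = (real j + 3 / 2) * (4 * a + 2)" by (simp add: algebra_simps)
  finally have upper: "real_of_int n / (4 * a + 2) \<le> real j + 3 / 2"
    using a by (simp add: field_simps)
  have "3 \<le> real_of_int n / (4 * a + 2)" using n a by (simp add: field_simps flip: a_def)
  then have j2: "2 \<le> j" using upper by linarith
  have "measure p {n..} \<le> measure p {m + int j * (2 * m - 1)..}"
    using lower by (intro measure_pmf.finite_measure_mono) auto
  also have "\<dots> \<le> (1 / 4) * (1 / 3) ^ j"
    using log_concave_tail_blocks[OF lc c m(1), of j] m(2) by (simp flip: a_def)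
  also have "\<dots> \<le> exp (- (real j + 3 / 2))" by (rule third_power_le_exp[OF j2])
  also have "\<dots> \<le> exp (- real_of_int n / (4 * a + 2))" using upper by simp
  finally show ?thesis by (simp add: a_def)
qed

text \<open>On the scale \<open>u = n / (4 * mean_abs p + 2)\<close> there are three regimes: for \<open>u \<le> 1 / 2\<close> the bound
  is at least 1, for \<open>u \<le> 3\<close> Markov's inequality suffices, and further out the geometric decay of
  log-concave tails takes over.\<close>

lemma log_concave_abs_tail:
  fixes p :: "int pmf"
  assumes lc: "log_concave_pmf p" and c: "centered_pmf p" and n: "n > 0"
  shows "measure p {k. n \<le> \<bar>k\<bar>} \<le> 2 * exp (- real_of_int n / (4 * mean_abs p + 2))"
proof -
  define a where "a = mean_abs p"
  have a: "a \<ge> 0" by (simp add: a_def)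
  define u where "u = real_of_int n / (4 * a + 2)"
  have u: "u > 0" "real_of_int n = u * (4 * a + 2)" using n a by (auto simp: u_def)
  have sets: "{k. n \<le> \<bar>k\<bar>} = {n..} \<union> {..- n}" using n by auto
  have union: "measure p {k. n \<le> \<bar>k\<bar>} = measure p {n..} + measure p {..- n}"
    unfolding sets using n by (intro measure_pmf.finite_measure_Union) auto
  consider "u \<le> 1 / 2" | "1 / 2 \<le> u" "u \<le> 3" | "3 \<le> u" by linarith
  then have "measure p {k. n \<le> \<bar>k\<bar>} \<le> 2 * exp (- u)"
  proof cases
    case 1
    have "1 / 2 \<le> exp (- u)" using exp_ge_add_one_self[of "- u"] 1 by linarith
    moreover have "measure p {k. n \<le> \<bar>k\<bar>} \<le> 1" by simp
    ultimately show ?thesis by linarith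
  next
    case 2
    have "measure p {k. n \<le> \<bar>k\<bar>} \<le> a / (2 * real_of_int n) + a / (2 * real_of_int n)"
      unfolding union a_def
      using centered_pmf_tail_le[OF c n] centered_pmf_tail_le[OF centered_reflect[OF c] n]
      by (intro add_mono) (simp_all add: measure_reflect mean_abs_reflect)
    also have "\<dots> = a / (u * (4 * a + 2))" by (simp add: u(2) flip: u(2))
    also have "\<dots> \<le> 1 / (4 * u)"
      using u(1) a by (simp add: divide_le_eq pos_divide_le_eq add_pos_nonneg field_simps)
    also have "\<dots> \<le> 2 * exp (- u)"
      using exp_le_linear[OF 2] u(1) by (simp add: exp_minus field_simps)
    finally show ?thesis .
  next
    case 3
    have far: "3 * (4 * mean_abs p + 2) \<le> real_of_int n"
      unfolding u(2) a_def[symmetric] using 3 a by (intro mult_right_mono) auto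
    have "measure p {n..} \<le> exp (- u)"
      using log_concave_far_tail[OF lc c far] by (simp add: u_def a_def)
    moreover have "measure p {..- n} \<le> exp (- u)"
      using log_concave_far_tail[OF log_concave_reflect[OF lc] centered_reflect[OF c], of n] far
      by (simp add: u_def a_def measure_reflect mean_abs_reflect)
    ultimately show ?thesis unfolding union by linarith
  qed
  then show ?thesis by (simp add: u_def a_def)
qed

section \<open>Layers of the variation and truncated exponential sums\<close>

text \<open>The bound on the right is the integral over the positive half-line of the minimum of \<open>c\<close> and
  \<open>C * exp (- x / b)\<close>; the two are equal at \<open>x = s\<close>.  As \<open>s\<close> need not be an integer, the sum is split at
  its floor, and convexity of the exponential pays for the fractional part without any loss.\<close>

lemma suminf_min_exp_le:
  fixes g :: "nat \<Rightarrow> real"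
  assumes "0 < c" "c \<le> C" "0 < b"
    and nonneg: "\<And>n. 0 \<le> g n" and flat: "\<And>n. g n \<le> c"
    and decay: "\<And>n. g n \<le> C * exp (- real (Suc n) / b)"
  shows "(\<Sum>n. ennreal (g n)) \<le> ennreal (c * b * (1 + ln (C / c)))"
proof -
  define s where "s = b * ln (C / c)"
  have "s \<ge> 0" using assms(1-3) by (simp add: s_def)
  define N where "N = nat \<lfloor>s\<rfloor>"
  define \<theta> where "\<theta> = s - real N"
  have \<theta>: "0 \<le> \<theta>" "\<theta> \<le> 1" using \<open>s \<ge> 0\<close> by (auto simp: \<theta>_def N_def) linarith
  define r where "r = exp (- 1 / b)"
  have r: "0 < r" "r < 1" using assms(3) by (auto simp: r_def)
  have power_r: "exp (- real n / b) = r ^ n" for n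
    by (simp add: r_def flip: exp_of_nat_mult)
  have geo: "(\<lambda>n. C * r ^ Suc N * r ^ n) sums (C * r ^ Suc N * (1 / (1 - r)))"
    using r by (intro sums_mult geometric_sums) auto
  have bound: "g (n + N) \<le> C * r ^ Suc N * r ^ n" for n
    using decay[of "n + N"] unfolding power_r by (simp add: power_add mult_ac)
  have tail: "summable (\<lambda>n. g (n + N))" "(\<Sum>n. g (n + N)) \<le> C * r ^ Suc N * (1 / (1 - r))"
  proof -
    show *: "summable (\<lambda>n. g (n + N))"
      by (rule summable_comparison_test'[OF sums_summable[OF geo], of 0]) (use bound nonneg in auto)
    show "(\<Sum>n. g (n + N)) \<le> C * r ^ Suc N * (1 / (1 - r))"
      using suminf_le[OF bound * sums_summable[OF geo]] sums_unique[OF geo] by simp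
  qed
  have summ: "summable g" using tail(1) by (simp add: summable_iff_shift)
  have "C * r ^ N = c * exp (\<theta> / b)"
  proof -
    have "exp (s / b) = C / c" using assms(1-3) by (simp add: s_def)
    then have "C = c * exp (s / b)" using assms(1) by simp
    then have "C * r ^ N = c * (exp (s / b) * exp (- real N / b))"
      unfolding power_r by (simp only: mult.assoc)
    also have "exp (s / b) * exp (- real N / b) = exp (\<theta> / b)"
      unfolding exp_add[symmetric] by (simp add: \<theta>_def diff_divide_distrib)
    finally show ?thesis .
  qed
  moreover have "exp (\<theta> / b) * (r / (1 - r)) \<le> b + \<theta>"
  proof -
    define E where "E = exp (1 / b)"
    have E: "E - 1 \<ge> 1 / b" using exp_ge_add_one_self[of "1 / b"] unfolding E_def by linarith
    have E1: "E - 1 > 0" using E assms(3) by (smt (verit) divide_pos_pos)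
    \<comment> \<open>The chord of \<open>exp\<close> between 0 and \<open>1 / b\<close>.\<close>
    have "exp (\<theta> / b) \<le> 1 + \<theta> * (E - 1)"
      using convex_onD[OF exp_convex, of \<theta> 0 "1 / b"] \<theta> by (simp add: E_def algebra_simps)
    moreover have "r / (1 - r) = 1 / (E - 1)"
      using E1 by (simp add: r_def E_def exp_minus field_simps)
    moreover have "1 / (E - 1) \<le> b"
      using E E1 assms(3) by (simp add: field_simps)
    ultimately have "exp (\<theta> / b) * (r / (1 - r)) \<le> (1 + \<theta> * (E - 1)) * (1 / (E - 1))"
      using E1 by (simp add: divide_right_mono)
    also have "\<dots> = 1 / (E - 1) + \<theta>" using E1 by (simp add: field_simps)
    also have "\<dots> \<le> b + \<theta>" using \<open>1 / (E - 1) \<le> b\<close> by simp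
    finally show ?thesis .
  qed
  ultimately have "(C * r ^ N) * (r / (1 - r)) \<le> c * (b + \<theta>)"
    using assms(1) by (simp only: mult.assoc mult_le_cancel_left_pos)
  then have tail_le: "C * r ^ Suc N * (1 / (1 - r)) \<le> c * (b + \<theta>)"
    by (simp add: mult_ac)
  have "(\<Sum>n. g n) = (\<Sum>n. g (n + N)) + (\<Sum>n<N. g n)"
    by (rule suminf_split_initial_segment[OF summ])
  also have "\<dots> \<le> c * (b + \<theta>) + real N * c"
    using tail(2) tail_le sum_bounded_above[of "{..<N}" g c] flat by auto
  also have "\<dots> = c * b * (1 + ln (C / c))"
    by (simp add: \<theta>_def s_def algebra_simps)
  finally have "(\<Sum>n. g n) \<le> c * b * (1 + ln (C / c))" .
  then show ?thesis
    using suminf_ennreal2[OF nonneg summ] by (simp add: ennreal_leI)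
qed

text \<open>Layer cake formula for the weight \<open>\<bar>k\<bar>\<close>, which counts the layers \<open>n < \<bar>k\<bar>\<close>.\<close>

lemma nn_integral_abs_layers:
  fixes w :: "int \<Rightarrow> ennreal"
  shows "(\<integral>\<^sup>+ k. ennreal \<bar>real_of_int k\<bar> * w k \<partial>count_space UNIV)
    = (\<Sum>n. \<integral>\<^sup>+ k. w k \<partial>count_space {k. int (Suc n) \<le> \<bar>k\<bar>})"
proof -
  have layers: "ennreal \<bar>real_of_int k\<bar> = (\<Sum>n. indicator {k. int (Suc n) \<le> \<bar>k\<bar>} k)" for k
  proof -
    have "(\<Sum>n. indicator {k. int (Suc n) \<le> \<bar>k\<bar>} k :: ennreal) = (\<Sum>n<nat \<bar>k\<bar>. indicator {k. int (Suc n) \<le> \<bar>k\<bar>} k)"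
      by (rule suminf_finite) (auto simp: indicator_def)
    also have "\<dots> = (\<Sum>n<nat \<bar>k\<bar>. 1)"
      by (intro sum.cong) (auto simp: indicator_def)
    also have "\<dots> = ennreal \<bar>real_of_int k\<bar>"
      by (simp add: ennreal_of_nat_eq_real_of_nat)
    finally show ?thesis by simp
  qed
  have "(\<integral>\<^sup>+ k. ennreal \<bar>real_of_int k\<bar> * w k \<partial>count_space UNIV)
    = (\<integral>\<^sup>+ k. (\<Sum>n. w k * indicator {k. int (Suc n) \<le> \<bar>k\<bar>} k) \<partial>count_space UNIV)"
    by (simp add: layers mult.commute[of _ "w _"])
  also have "\<dots> = (\<Sum>n. \<integral>\<^sup>+ k. w k * indicator {k. int (Suc n) \<le> \<bar>k\<bar>} k \<partial>count_space UNIV)"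
    by (rule nn_integral_suminf) simp
  finally show ?thesis by (simp add: nn_integral_count_space_indicator)
qed

lemma summable_abs_pmf_diff:
  "Infinite_Set_Sum.abs_summable_on (\<lambda>k. \<bar>pmf p k - pmf q k\<bar>) A"
proof -
  have "Infinite_Set_Sum.abs_summable_on (\<lambda>k. norm (pmf p k - pmf q k)) A"
    by (intro abs_summable_on_norm_iff[THEN iffD2] abs_summable_on_diff pmf_abs_summable)
  then show ?thesis by simp
qed

text \<open>Splitting at the set where \<open>p\<close> dominates expresses the variation by differences of probabilities,
  which both the total variation bound and the tail bounds control.\<close>

lemma infsetsum_abs_pmf_diff:
  fixes p q :: "'a pmf"
  defines "B \<equiv> {k. pmf q k \<le> pmf p k}"
  shows "infsetsum (\<lambda>k. \<bar>pmf p k - pmf q k\<bar>) A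
    = (measure p (A \<inter> B) - measure q (A \<inter> B)) + (measure q (A - B) - measure p (A - B))"
proof -
  have "infsetsum (\<lambda>k. \<bar>pmf p k - pmf q k\<bar>) ((A \<inter> B) \<union> (A - B))
      = infsetsum (\<lambda>k. \<bar>pmf p k - pmf q k\<bar>) (A \<inter> B) + infsetsum (\<lambda>k. \<bar>pmf p k - pmf q k\<bar>) (A - B)"
    by (rule infsetsum_Un_disjoint) (auto simp: summable_abs_pmf_diff)
  also have "infsetsum (\<lambda>k. \<bar>pmf p k - pmf q k\<bar>) (A \<inter> B) = infsetsum (\<lambda>k. pmf p k - pmf q k) (A \<inter> B)"
    by (rule infsetsum_cong) (auto simp: B_def)
  also have "\<dots> = measure p (A \<inter> B) - measure q (A \<inter> B)"
    by (simp add: measure_pmf_conv_infsetsum infsetsum_diff pmf_abs_summable)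
  also have "infsetsum (\<lambda>k. \<bar>pmf p k - pmf q k\<bar>) (A - B) = infsetsum (\<lambda>k. pmf q k - pmf p k) (A - B)"
    by (rule infsetsum_cong) (auto simp: B_def)
  also have "\<dots> = measure q (A - B) - measure p (A - B)"
    by (simp add: measure_pmf_conv_infsetsum infsetsum_diff pmf_abs_summable)
  also have "(A \<inter> B) \<union> (A - B) = A" by auto
  finally show ?thesis .
qed

lemma nn_integral_abs_pmf_diff:
  "(\<integral>\<^sup>+ k. ennreal \<bar>pmf p k - pmf q k\<bar> \<partial>count_space A) = ennreal (infsetsum (\<lambda>k. \<bar>pmf p k - pmf q k\<bar>) A)"
  by (rule nn_integral_conv_infsetsum) (auto simp: summable_abs_pmf_diff)

section \<open>Coupling and Wasserstein distance\<close>

text \<open>The common mass \<open>min p q\<close> stays on the diagonal; the surplus \<open>P\<close> of \<open>p\<close> and the surplus \<open>Q\<close> of \<open>q\<close>,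
  which have the same total mass \<open>t\<close>, are coupled independently.  If \<open>t = 0\<close> both surpluses vanish, so
  that the convention \<open>x / 0 = 0\<close> gives the diagonal coupling.  A cost that splits as
  \<open>f x + f y\<close> off the diagonal only sees the marginals of the moved mass, and \<open>P + Q = \<bar>p - q\<bar>\<close>.\<close>

lemma maximal_coupling:
  fixes p q :: "'a pmf"
  obtains J where "map_pmf fst J = p" "map_pmf snd J = q"
    and "\<And>f. (\<integral>\<^sup>+ z. (if fst z = snd z then 0 else f (fst z) + f (snd z)) \<partial>measure_pmf J)
         \<le> (\<integral>\<^sup>+ x. f x * ennreal \<bar>pmf p x - pmf q x\<bar> \<partial>count_space UNIV)"
proof -
  define m where "m x = min (pmf p x) (pmf q x)" for x
  define P where "P x = pmf p x - m x" for x
  define Q where "Q x = pmf q x - m x" for x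
  define t where "t = 1 - infsetsum m UNIV"
  have nonneg: "0 \<le> m x" "0 \<le> P x" "0 \<le> Q x" for x
    by (auto simp: m_def P_def Q_def)
  have summ_m: "Infinite_Set_Sum.abs_summable_on m UNIV"
    by (rule abs_summable_on_comparison_test[OF pmf_abs_summable[of p]]) (auto simp: m_def)
  have sum1: "infsetsum (pmf r) UNIV = 1" for r :: "'a pmf"
    by (simp flip: measure_pmf_conv_infsetsum)
  have int: "(\<integral>\<^sup>+ x. ennreal (P x) \<partial>count_space UNIV) = ennreal t"
            "(\<integral>\<^sup>+ x. ennreal (Q x) \<partial>count_space UNIV) = ennreal t"
    using summ_m nonneg
    by (subst nn_integral_conv_infsetsum;
        auto simp: P_def Q_def t_def infsetsum_diff sum1 pmf_abs_summable intro!: abs_summable_on_diff)+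
  have "infsetsum m UNIV \<le> infsetsum (pmf p) UNIV"
    by (intro infsetsum_mono summ_m pmf_abs_summable) (auto simp: m_def)
  then have t: "t \<ge> 0" by (simp add: t_def sum1)
  have t0: "P x = 0 \<and> Q x = 0" if "t = 0" for x
  proof -
    have "ennreal (P x) \<le> ennreal t"
      unfolding int(1)[symmetric] by (rule nn_integral_ge_point) simp
    moreover have "ennreal (Q x) \<le> ennreal t"
      unfolding int(2)[symmetric] by (rule nn_integral_ge_point) simp
    ultimately show ?thesis using that nonneg[of x] by (simp add: ennreal_le_iff antisym)
  qed
  have scaled: "(\<integral>\<^sup>+ y. ennreal (P x * Q y / t) \<partial>count_space UNIV) = ennreal (P x)"
               "(\<integral>\<^sup>+ y. ennreal (P y * Q x / t) \<partial>count_space UNIV) = ennreal (Q x)" for x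
  proof -
    have "(\<integral>\<^sup>+ y. ennreal (P x * Q y / t) \<partial>count_space UNIV)
        = (\<integral>\<^sup>+ y. ennreal (P x / t) * ennreal (Q y) \<partial>count_space UNIV)"
      using nonneg t by (simp flip: ennreal_mult)
    also have "\<dots> = ennreal (P x / t) * ennreal t" by (simp add: nn_integral_cmult int)
    also have "\<dots> = ennreal (P x)" using t t0[of x] nonneg by (cases "t = 0") (simp_all flip: ennreal_mult)
    finally show "(\<integral>\<^sup>+ y. ennreal (P x * Q y / t) \<partial>count_space UNIV) = ennreal (P x)" .
    have "(\<integral>\<^sup>+ y. ennreal (P y * Q x / t) \<partial>count_space UNIV)
        = (\<integral>\<^sup>+ y. ennreal (Q x / t) * ennreal (P y) \<partial>count_space UNIV)"
      using nonneg t by (simp add: mult.commute flip: ennreal_mult)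
    also have "\<dots> = ennreal (Q x / t) * ennreal t" by (simp add: nn_integral_cmult int)
    also have "\<dots> = ennreal (Q x)" using t t0[of x] nonneg by (cases "t = 0") (simp_all flip: ennreal_mult)
    finally show "(\<integral>\<^sup>+ y. ennreal (P y * Q x / t) \<partial>count_space UNIV) = ennreal (Q x)" .
  qed
  define j where "j z = (if fst z = snd z then m (fst z) else 0) + P (fst z) * Q (snd z) / t" for z
  have j0: "0 \<le> j z" for z using nonneg t by (auto simp: j_def)
  have j_split: "ennreal (j (x, y)) = ennreal (if x = y then m x else 0) + ennreal (P x * Q y / t)" for x y
    unfolding j_def fst_conv snd_conv using nonneg t by (intro ennreal_plus) auto
  have diag: "(\<integral>\<^sup>+ y. ennreal (if x = y then m x else 0) \<partial>count_space UNIV) = ennreal (m x)"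
             "(\<integral>\<^sup>+ y. ennreal (if y = x then m y else 0) \<partial>count_space UNIV) = ennreal (m x)" for x
  proof -
    have "(\<integral>\<^sup>+ y. ennreal (m x) * indicator {x} y \<partial>count_space UNIV) = ennreal (m x)"
      by (simp add: nn_integral_cmult_indicator)
    then show "(\<integral>\<^sup>+ y. ennreal (if x = y then m x else 0) \<partial>count_space UNIV) = ennreal (m x)"
      "(\<integral>\<^sup>+ y. ennreal (if y = x then m y else 0) \<partial>count_space UNIV) = ennreal (m x)"
      by (auto elim!: trans[rotated] intro!: nn_integral_cong simp: indicator_def)
  qed
  have row: "(\<integral>\<^sup>+ y. ennreal (j (x, y)) \<partial>count_space UNIV) = ennreal (pmf p x)" for x
    by (simp add: j_split nn_integral_add scaled diag nonneg flip: ennreal_plus) (simp add: P_def)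
  have col: "(\<integral>\<^sup>+ x. ennreal (j (x, y)) \<partial>count_space UNIV) = ennreal (pmf q y)" for y
    by (simp add: j_split nn_integral_add scaled diag nonneg flip: ennreal_plus) (simp add: Q_def)
  have one: "(\<integral>\<^sup>+ z. ennreal (j z) \<partial>count_space UNIV) = 1"
    using nn_integral_fst_count_space[of "\<lambda>z. ennreal (j z)"] by (simp add: row nn_integral_pmf)
  define J where "J = embed_pmf j"
  have J: "pmf J z = j z" for z unfolding J_def by (rule pmf_embed_pmf[OF j0 one])
  have "ennreal (pmf (map_pmf fst J) x) = ennreal (pmf p x)" for x
  proof -
    have "ennreal (pmf (map_pmf fst J) x)
        = (\<integral>\<^sup>+ z. ennreal (j z) * indicator (fst -` {x}) z \<partial>count_space UNIV)"
      by (simp add: ennreal_pmf_map nn_integral_measure_pmf J)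
    also have "\<dots> = (\<integral>\<^sup>+ x'. ennreal (pmf p x') * indicator {x} x' \<partial>count_space UNIV)"
      by (subst nn_integral_fst_count_space[symmetric])
        (auto intro!: nn_integral_cong simp: row indicator_def)
    also have "\<dots> = ennreal (pmf p x)" by (simp add: nn_integral_pmf emeasure_pmf_single flip: nn_integral_count_space_indicator)
    finally show ?thesis .
  qed
  then have fst: "map_pmf fst J = p" by (intro pmf_eqI) simp
  have "ennreal (pmf (map_pmf snd J) y) = ennreal (pmf q y)" for y
  proof -
    have "ennreal (pmf (map_pmf snd J) y)
        = (\<integral>\<^sup>+ z. ennreal (j z) * indicator (snd -` {y}) z \<partial>count_space UNIV)"
      by (simp add: ennreal_pmf_map nn_integral_measure_pmf J)
    also have "\<dots> = (\<integral>\<^sup>+ y'. ennreal (pmf q y') * indicator {y} y' \<partial>count_space UNIV)"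
      by (subst nn_integral_snd_count_space[symmetric])
        (auto intro!: nn_integral_cong simp: col indicator_def)
    also have "\<dots> = ennreal (pmf q y)" by (simp add: nn_integral_pmf emeasure_pmf_single flip: nn_integral_count_space_indicator)
    finally show ?thesis .
  qed
  then have snd: "map_pmf snd J = q" by (intro pmf_eqI) simp
  have cost: "(\<integral>\<^sup>+ z. (if fst z = snd z then 0 else f (fst z) + f (snd z)) \<partial>measure_pmf J)
         \<le> (\<integral>\<^sup>+ x. f x * ennreal \<bar>pmf p x - pmf q x\<bar> \<partial>count_space UNIV)" for f
  proof -
    let ?r = "\<lambda>z. ennreal (P (fst z) * Q (snd z) / t)"
    have "(\<integral>\<^sup>+ z. (if fst z = snd z then 0 else f (fst z) + f (snd z)) \<partial>measure_pmf J)
        \<le> (\<integral>\<^sup>+ z. f (fst z) * ?r z + f (snd z) * ?r z \<partial>count_space UNIV)"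
      unfolding nn_integral_measure_pmf J
      by (intro nn_integral_mono) (auto simp: j_def algebra_simps)
    also have "\<dots> = (\<integral>\<^sup>+ z. f (fst z) * ?r z \<partial>count_space UNIV) + (\<integral>\<^sup>+ z. f (snd z) * ?r z \<partial>count_space UNIV)"
      by (rule nn_integral_add) auto
    also have "(\<integral>\<^sup>+ z. f (fst z) * ?r z \<partial>count_space UNIV) = (\<integral>\<^sup>+ x. f x * ennreal (P x) \<partial>count_space UNIV)"
      by (subst nn_integral_fst_count_space[symmetric]) (simp add: nn_integral_cmult scaled)
    also have "(\<integral>\<^sup>+ z. f (snd z) * ?r z \<partial>count_space UNIV) = (\<integral>\<^sup>+ x. f x * ennreal (Q x) \<partial>count_space UNIV)"
      by (subst nn_integral_snd_count_space[symmetric]) (simp add: nn_integral_cmult scaled)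
    also have "(\<integral>\<^sup>+ x. f x * ennreal (P x) \<partial>count_space UNIV) + (\<integral>\<^sup>+ x. f x * ennreal (Q x) \<partial>count_space UNIV)
       = (\<integral>\<^sup>+ x. f x * ennreal (P x) + f x * ennreal (Q x) \<partial>count_space UNIV)"
      by (rule nn_integral_add[symmetric]) auto
    also have "\<dots> = (\<integral>\<^sup>+ x. f x * ennreal \<bar>pmf p x - pmf q x\<bar> \<partial>count_space UNIV)"
    proof (rule nn_integral_cong)
      fix x
      have "P x + Q x = \<bar>pmf p x - pmf q x\<bar>" by (auto simp: P_def Q_def m_def)
      then show "f x * ennreal (P x) + f x * ennreal (Q x) = f x * ennreal \<bar>pmf p x - pmf q x\<bar>"
        using ennreal_plus[OF nonneg(2,3), of x x] by (simp flip: distrib_left)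
    qed
    finally show ?thesis .
  qed
  show ?thesis using that fst snd cost by blast
qed

text \<open>The maximal coupling, with the distance bounded by the detour through the origin.\<close>

lemma wasserstein1_le_weighted_variation:
  fixes p q :: "int pmf"
  shows "wasserstein1 (real_law p) (real_law q)
    \<le> (\<integral>\<^sup>+ k. ennreal \<bar>real_of_int k\<bar> * ennreal \<bar>pmf p k - pmf q k\<bar> \<partial>count_space UNIV)"
proof -
  obtain J where fst: "map_pmf fst J = p" and snd: "map_pmf snd J = q"
    and cost: "\<And>f. (\<integral>\<^sup>+ z. (if fst z = snd z then 0 else f (fst z) + f (snd z)) \<partial>measure_pmf J)
         \<le> (\<integral>\<^sup>+ x. f x * ennreal \<bar>pmf p x - pmf q x\<bar> \<partial>count_space UNIV)"
    using maximal_coupling by blast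
  let ?e = "\<lambda>z :: int \<times> int. (real_of_int (fst z), real_of_int (snd z))"
  define D where "D = distr (measure_pmf J) (borel \<Otimes>\<^sub>M borel) ?e"
  have e: "?e \<in> measurable (measure_pmf J) (borel \<Otimes>\<^sub>M borel)"
    by (simp add: space_pair_measure)
  have "distr D borel fst = real_law p"
    unfolding D_def real_law_def fst[symmetric] map_pmf_rep_eq
    by (subst (1 2) distr_distr) (auto simp: comp_def space_pair_measure)
  moreover have "distr D borel snd = real_law q"
    unfolding D_def real_law_def snd[symmetric] map_pmf_rep_eq
    by (subst (1 2) distr_distr) (auto simp: comp_def space_pair_measure)
  ultimately have "D \<in> couplings (real_law p) (real_law q)"
    using measure_pmf.prob_space_distr[OF e] by (simp add: couplings_def D_def)
  then have "wasserstein1 (real_law p) (real_law q) \<le> (\<integral>\<^sup>+ z. ennreal \<bar>fst z - snd z\<bar> \<partial>D)"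
    unfolding wasserstein1_def by (rule INF_lower)
  also have "\<dots> = (\<integral>\<^sup>+ z. ennreal \<bar>real_of_int (fst z) - real_of_int (snd z)\<bar> \<partial>measure_pmf J)"
    unfolding D_def by (subst nn_integral_distr) (auto simp: space_pair_measure)
  also have "\<dots> \<le> (\<integral>\<^sup>+ z. (if fst z = snd z then 0
      else ennreal \<bar>real_of_int (fst z)\<bar> + ennreal \<bar>real_of_int (snd z)\<bar>) \<partial>measure_pmf J)"
    by (intro nn_integral_mono) (auto simp flip: ennreal_plus intro!: ennreal_leI)
  also have "\<dots> \<le> (\<integral>\<^sup>+ k. ennreal \<bar>real_of_int k\<bar> * ennreal \<bar>pmf p k - pmf q k\<bar> \<partial>count_space UNIV)"
    by (rule cost)
  finally show ?thesis .
qed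

section \<open>Levy-Prokhorov distance on the integers\<close>

lemma measure_real_law_le_1: "measure (real_law p) A \<le> 1"
  unfolding real_law_def
  by (intro prob_space.prob_le_1 measure_pmf.prob_space_distr) simp

lemma levy_prokhorov_real_law_le_1: "levy_prokhorov (real_law p) (real_law q) \<le> 1"
  unfolding levy_prokhorov_def
proof (rule cInf_lower)
  show "1 \<in> {\<epsilon>. \<epsilon> > 0 \<and> (\<forall>A \<in> sets borel.
      measure (real_law p) A \<le> measure (real_law q) (thickening \<epsilon> A) + \<epsilon>)}"
    by (auto intro!: add_increasing measure_real_law_le_1)
  show "bdd_below {\<epsilon>. \<epsilon> > 0 \<and> (\<forall>A \<in> sets borel.
      measure (real_law p) A \<le> measure (real_law q) (thickening \<epsilon> A) + \<epsilon>)}"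
    by (intro bdd_belowI[of _ 0]) auto
qed

text \<open>On the integers the Levy-Prokhorov distance dominates the total variation distance: a thickening
  by less than 1 adds no integer to a set of integers, and thickenings by 1 or more allow for an
  error that is no smaller than any difference of probabilities.\<close>

lemma measure_diff_le_levy_prokhorov:
  fixes p q :: "int pmf"
  shows "measure p A - measure q A \<le> levy_prokhorov (real_law p) (real_law q)"
  unfolding levy_prokhorov_def
proof (rule cInf_greatest)
  show "{\<epsilon>. \<epsilon> > 0 \<and> (\<forall>B \<in> sets borel. measure (real_law p) B \<le> measure (real_law q) (thickening \<epsilon> B) + \<epsilon>)} \<noteq> {}"
    by (auto intro!: exI[of _ 1] add_increasing measure_real_law_le_1)
next
  fix \<epsilon> assume "\<epsilon> \<in> {\<epsilon>. \<epsilon> > 0 \<and> (\<forall>B \<in> sets borel. measure (real_law p) B \<le> measure (real_law q) (thickening \<epsilon> B) + \<epsilon>)}"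
  then have pos: "\<epsilon> > 0"
    and LP: "\<And>B. B \<in> sets borel \<Longrightarrow> measure (real_law p) B \<le> measure (real_law q) (thickening \<epsilon> B) + \<epsilon>"
    by auto
  have law: "measure (real_law r) B = measure r (real_of_int -` B)" if "B \<in> sets borel" for r B
    using that by (simp add: real_law_def measure_distr)
  show "measure p A - measure q A \<le> \<epsilon>"
  proof (cases "1 \<le> \<epsilon>")
    case True
    have "measure p A \<le> 1" "0 \<le> measure q A" by auto
    then show ?thesis using True by linarith
  next
    case False
    define B where "B = real_of_int ` A"
    have B: "B \<in> sets borel"
      unfolding B_def by (rule sets.countable) simp_all
    have thick: "thickening \<epsilon> B \<in> sets borel"
    proof (cases "B = {}")
      case False
      have "open {x. infdist x B < \<epsilon>}"
        by (intro open_Collect_less continuous_intros)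
      then show ?thesis using False by (simp add: thickening_def)
    qed (simp add: thickening_def)
    have "real_of_int -` thickening \<epsilon> B \<subseteq> A"
    proof
      fix k assume "k \<in> real_of_int -` thickening \<epsilon> B"
      then have "B \<noteq> {}" "infdist (real_of_int k) B < 1"
        using False by (auto simp: thickening_def split: if_splits)
      then obtain i where i: "i \<in> A" "dist (real_of_int k) (real_of_int i) < 1"
        using cInf_lessD[of "dist (real_of_int k) ` B" 1] by (auto simp: infdist_notempty B_def)
      then have "real_of_int \<bar>k - i\<bar> < 1" by (simp add: dist_real_def)
      then have "k = i" by linarith
      then show "k \<in> A" using i by simp
    qed
    then have "measure q (real_of_int -` thickening \<epsilon> B) \<le> measure q A"
      by (intro measure_pmf.finite_measure_mono) auto
    moreover have "real_of_int -` B = A" by (auto simp: B_def)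
    ultimately show ?thesis using LP[OF B] by (simp add: law B thick)
  qed
qed

section \<open>Comparison of the two distances\<close>

theorem theorem3p1:
  fixes \<mu> \<nu> :: "int pmf"
  assumes "log_concave_pmf \<mu>" and "centered_pmf \<mu>"
    and "log_concave_pmf \<nu>" and "centered_pmf \<nu>"
  shows "let d = levy_prokhorov (real_law \<mu>) (real_law \<nu>);
             a = measure_pmf.expectation \<mu> (\<lambda>k. \<bar>real_of_int k\<bar>);
             b = measure_pmf.expectation \<nu> (\<lambda>k. \<bar>real_of_int k\<bar>)
         in wasserstein1 (real_law \<mu>) (real_law \<nu>) \<le>
              ennreal (if d = 0 then 0
                       else 4 * d * (2 * max a b + 1) *
                         ln (4 * exp 1 * (a + b + 1) / ((2 * max a b + 1) * d)))"
proof -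
  define d where "d = levy_prokhorov (real_law \<mu>) (real_law \<nu>)"
  define a where "a = mean_abs \<mu>"
  define b where "b = mean_abs \<nu>"
  have ab: "a \<ge> 0" "b \<ge> 0" by (auto simp: a_def b_def)
  define K where "K = 2 * max a b + 1"
  have K: "K \<ge> 2 * a + 1" "K \<ge> 2 * b + 1" "K > 0" "K \<le> 2 * (a + b + 1)"
    using ab by (auto simp: K_def)
  define g where "g n = infsetsum (\<lambda>k. \<bar>pmf \<mu> k - pmf \<nu> k\<bar>) {k. int (Suc n) \<le> \<bar>k\<bar>}" for n
  have W: "wasserstein1 (real_law \<mu>) (real_law \<nu>) \<le> (\<Sum>n. ennreal (g n))"
    using wasserstein1_le_weighted_variation[of \<mu> \<nu>]
    by (simp only: nn_integral_abs_layers nn_integral_abs_pmf_diff g_def)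
  have tv: "measure \<mu> A - measure \<nu> A \<le> d" for A
    unfolding d_def by (rule measure_diff_le_levy_prokhorov)
  have tv': "measure \<nu> A - measure \<mu> A \<le> d" for A
    using tv[of "- A"] measure_pmf.prob_compl[of A \<mu>] measure_pmf.prob_compl[of A \<nu>]
    by (simp add: Compl_eq_Diff_UNIV)
  have d: "0 \<le> d" "d \<le> 1"
    using tv[of "{}"] levy_prokhorov_real_law_le_1[of \<mu> \<nu>] by (auto simp: d_def)
  have g_nonneg: "0 \<le> g n" for n
    unfolding g_def by (rule infsetsum_nonneg) simp
  have g_flat: "g n \<le> 2 * d" for n
    unfolding g_def infsetsum_abs_pmf_diff by (smt (verit) tv tv')
  show ?thesis
  proof (cases "d = 0")
    case True
    then have "g n = 0" for n using g_flat[of n] g_nonneg[of n] by simp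
    then show ?thesis using W True by (simp add: d_def Let_def)
  next
    case False
    then have "d > 0" using d by simp
    have tail: "measure p {k. int (Suc n) \<le> \<bar>k\<bar>} \<le> 2 * exp (- real (Suc n) / (2 * K))"
      if "log_concave_pmf p" "centered_pmf p" "2 * mean_abs p + 1 \<le> K" for p n
    proof -
      have "measure p {k. int (Suc n) \<le> \<bar>k\<bar>} \<le> 2 * exp (- real_of_int (int (Suc n)) / (4 * mean_abs p + 2))"
        by (rule log_concave_abs_tail[OF that(1,2)]) simp
      also have "\<dots> \<le> 2 * exp (- real (Suc n) / (2 * K))"
      proof -
        have "0 < 4 * mean_abs p + 2" by (simp add: add_nonneg_pos)
        then have "real (Suc n) / (2 * K) \<le> real (Suc n) / (4 * mean_abs p + 2)"
          using that(3) by (intro divide_left_mono) auto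
        then show ?thesis
          by (simp only: minus_divide_left[symmetric] neg_le_iff_le of_int_of_nat_eq
              mult_le_cancel_left_pos exp_le_cancel_iff zero_less_numeral)
      qed
      finally show ?thesis .
    qed
    have g_decay: "g n \<le> 4 * exp (- real (Suc n) / (2 * K))" for n
    proof -
      let ?A = "{k. int (Suc n) \<le> \<bar>k\<bar>}"
      have "g n \<le> measure \<mu> ?A + measure \<nu> ?A"
      proof -
        define B where "B = {k. pmf \<nu> k \<le> pmf \<mu> k}"
        have "measure \<mu> (?A \<inter> B) \<le> measure \<mu> ?A" "measure \<nu> (?A - B) \<le> measure \<nu> ?A"
          by (intro measure_pmf.finite_measure_mono; auto)+
        moreover have "0 \<le> measure \<nu> (?A \<inter> B)" "0 \<le> measure \<mu> (?A - B)" by auto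
        ultimately show ?thesis
          unfolding g_def infsetsum_abs_pmf_diff B_def by linarith
      qed
      then show ?thesis
        using tail[OF assms(1,2), of n] tail[OF assms(3,4), of n] K
        by (simp add: a_def b_def)
    qed
    have "wasserstein1 (real_law \<mu>) (real_law \<nu>) \<le> ennreal (2 * d * (2 * K) * (1 + ln (4 / (2 * d))))"
      using suminf_min_exp_le[OF _ _ _ g_nonneg g_flat g_decay] W \<open>d > 0\<close> d K
      by (force intro: order_trans)
    also have "\<dots> \<le> ennreal (4 * d * K * ln (4 * exp 1 * (a + b + 1) / (K * d)))"
    proof -
      \<comment> \<open>The logarithm absorbs the constant because \<open>K \<le> 2 * (a + b + 1)\<close>.\<close>
      have "1 + ln (4 / (2 * d)) = ln (exp 1 * (2 / d))"
        using \<open>d > 0\<close> by (subst ln_mult) auto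
      also have "\<dots> \<le> ln (4 * exp 1 * (a + b + 1) / (K * d))"
      proof (rule ln_mono)
        have "exp 1 * (2 / d) = 2 * exp 1 * K / (K * d)" using K by simp
        also have "\<dots> \<le> 4 * exp 1 * (a + b + 1) / (K * d)"
        proof (rule divide_right_mono)
          show "2 * exp 1 * K \<le> 4 * exp 1 * (a + b + 1)"
            using mult_left_mono[OF K(4), of "2 * exp 1"] by (simp add: algebra_simps)
        qed (use K \<open>d > 0\<close> in simp)
        finally show "exp 1 * (2 / d) \<le> 4 * exp 1 * (a + b + 1) / (K * d)" .
      qed (use K ab \<open>d > 0\<close> in auto)
      finally have "(4 * d * K) * (1 + ln (4 / (2 * d))) \<le> (4 * d * K) * ln (4 * exp 1 * (a + b + 1) / (K * d))"
        using K \<open>d > 0\<close> by (intro mult_left_mono) auto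
      then show ?thesis by (intro ennreal_leI) (simp add: mult_ac)
    qed
    finally show ?thesis using False by (simp add: Let_def d_def a_def b_def K_def)
  qed
qed

end
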